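(* Let $n\in\mathbb{N}$. Then $$t(1,1,1,9;n)=\begin{cases}4\sigma(2n+3)+12\sigma\!\left(\dfrac{2n+3}{9}\right) & \text{if } n\equiv0\pmod3,\\[2pt] 8\sigma(2n+3) & \text{if } n\equiv1\pmod3,\\[2pt] 4\big(\sigma(2n+3)-c(2n+3)\big) & \text{if } n\equiv2\pmod 3.\end{cases}$$
   Context: $\mathbb{N}$ denotes the set of positive integers. For $a,b,c,d\in\mathbb{N}$ and an integer $m\ge0$, $t(a,b,c,d;m)$ is the number of $(x,y,z,w)\in\mathbb{Z}^4$ with $m = a\frac{x(x-1)}{2}+b\frac{y(y-1)}{2}+c\frac{z(z-1)}{2}+d\frac{w(w-1)}{2}$. $\sigma(m)$ is the sum of the positive divisors of $m$ when $m\in\mathbb{N}$, and $\sigma(x)=0$ when $x\notin\mathbb{N}$ (e.g. when $(2n+3)/9$ is not an integer). The integers $c(m)$ ($m\ge1$) are defined by the power series identity $q\prod_{k=1}^\infty(1-q^{6k})^4=\sum_{m=1}^\infty c(m)q^m$ ($|q|<1$); equivalently $c(m)=\frac13\sum(-1)^a a$, summed over $(a,b)\in\mathbb{Z}^2$ with $4m=a^2+3b^2$, $a\equiv2\pmod3$, $b\equiv a+2\pmod 4$. *)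

theory Defs
  imports "HOL-Complex_Analysis.Complex_Analysis"
begin

text \<open>
  For every integer \<open>x\<close> the product \<open>x * (x - 1)\<close> is even, so the integer divisions by 2 are exact.
\<close>
definition tri_reps :: "nat \<Rightarrow> nat \<Rightarrow> nat \<Rightarrow> nat \<Rightarrow> nat \<Rightarrow> nat" where
  "tri_reps a b c d m =
     card {(x :: int, y :: int, z :: int, w :: int).
             int m = int a * (x * (x - 1) div 2) + int b * (y * (y - 1) div 2) +
                     int c * (z * (z - 1) div 2) + int d * (w * (w - 1) div 2)}"

definition divisor_sigma :: "rat \<Rightarrow> nat" where
  "divisor_sigma x = (if \<exists>m :: nat. m > 0 \<and> x = of_nat m then \<Sum>k | k dvd nat \<lfloor>x\<rfloor>. k else 0)"

text \<open>
  The coefficients of the formal power series \<open>q * (\<Prod>k\<ge>1. (1 - q ^ (6 * k)) ^ 4)\<close>;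
  the infinite product is taken with respect to the topology of formal power series.
  The lemmas \<open>c_coeff_has_prod\<close> and \<open>c_coeff_sums\<close> below show that the product converges and that
  the identity holds analytically for \<open>norm q < 1\<close>.
\<close>
definition c_coeff :: "nat \<Rightarrow> int" where
  "c_coeff m = fps_nth (fps_X * (\<Prod>k. (1 - fps_X ^ (6 * (k + 1))) ^ 4)) m"


lemma divisor_sigma_of_nat: "m > 0 \<Longrightarrow> divisor_sigma (of_nat m) = (\<Sum>k | k dvd m. k)"
  by (auto simp: divisor_sigma_def)

lemma finite_tri_reps:
  assumes "a > 0" "b > 0" "c > 0" "d > 0"
  shows "finite {(x :: int, y :: int, z :: int, w :: int).
             int m = int a * (x * (x - 1) div 2) + int b * (y * (y - 1) div 2) +
                     int c * (z * (z - 1) div 2) + int d * (w * (w - 1) div 2)}"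
    (is "finite ?S")
proof -
  define K where "K = 2 * int m + 3"
  have nonneg: "x * (x - 1) div 2 \<ge> 0" for x :: int
  proof -
    have "x * (x - 1) \<ge> 0"
      by (cases "x \<ge> 1") (auto intro: mult_nonneg_nonneg mult_nonpos_nonpos)
    thus ?thesis by simp
  qed
  have bd: "x \<in> {-K..K}" if le: "x * (x - 1) div 2 \<le> int m" for x :: int
  proof -
    have le': "x * (x - 1) \<le> 2 * int m + 1" using le by linarith
    have "x \<le> K"
    proof (rule ccontr)
      assume "\<not> x \<le> K"
      hence "x - 1 \<ge> K" "x \<ge> 1" by (auto simp: K_def)
      hence "1 * K \<le> x * (x - 1)" by (intro mult_mono) (auto simp: K_def)
      thus False using le' by (simp add: K_def)
    qed
    moreover have "-K \<le> x"
    proof (rule ccontr)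
      assume "\<not> -K \<le> x"
      hence "-x \<ge> K" "1 - x \<ge> 1" by (auto simp: K_def)
      hence "K * 1 \<le> (-x) * (1 - x)" by (intro mult_mono) (auto simp: K_def)
      thus False using le' by (simp add: K_def algebra_simps)
    qed
    ultimately show ?thesis by simp
  qed
  have ge: "t \<le> int e * t" if "e > 0" "t \<ge> 0" for e :: nat and t :: int
    using mult_right_mono[of 1 "int e" t] that by simp
  have "?S \<subseteq> {-K..K} \<times> {-K..K} \<times> {-K..K} \<times> {-K..K}"
  proof safe
    fix x y z w :: int
    assume eq: "int m = int a * (x * (x - 1) div 2) + int b * (y * (y - 1) div 2) +
                        int c * (z * (z - 1) div 2) + int d * (w * (w - 1) div 2)"
    have "x * (x - 1) div 2 \<le> int m \<and> y * (y - 1) div 2 \<le> int m \<and>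
          z * (z - 1) div 2 \<le> int m \<and> w * (w - 1) div 2 \<le> int m"
      using ge[OF assms(1) nonneg[of x]] ge[OF assms(2) nonneg[of y]]
            ge[OF assms(3) nonneg[of z]] ge[OF assms(4) nonneg[of w]]
            nonneg[of x] nonneg[of y] nonneg[of z] nonneg[of w]
      unfolding eq by linarith
    thus "x \<in> {-K..K}" "y \<in> {-K..K}" "z \<in> {-K..K}" "w \<in> {-K..K}"
      using bd by blast+
  qed
  thus ?thesis by (rule finite_subset) auto
qed

lemma c_coeff_has_prod:
  "(\<lambda>k. (1 - fps_X ^ (6 * (k + 1))) ^ 4 :: int fps) has_prod
     (\<Prod>k. (1 - fps_X ^ (6 * (k + 1))) ^ 4)"
proof -
  define f :: "nat \<Rightarrow> int fps" where "f = (\<lambda>k. (1 - fps_X ^ (6 * (k + 1))) ^ 4)"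
  have f0: "fps_nth (f k) 0 = 1" for k
    by (simp add: f_def fps_power_zeroth power_0_left)
  have nz: "f k \<noteq> 0" for k using f0[of k] by auto
  have sub: "subdegree (f k - 1) > n" if k: "k > n" for n k
  proof -
    have eq: "f k - 1 = fps_X ^ (6 * (k + 1)) *
                (- 4 + 6 * fps_X ^ (6 * (k + 1)) - 4 * (fps_X ^ (6 * (k + 1))) ^ 2
                   + (fps_X ^ (6 * (k + 1))) ^ 3)" (is "_ = _ * ?g")
      unfolding f_def by algebra
    have ne: "f k - 1 \<noteq> 0"
    proof
      assume "f k - 1 = 0"
      hence "?g = 0" unfolding eq by simp
      hence "fps_nth ?g 0 = 0" by (simp only: fps_zero_nth)
      moreover have "fps_nth ?g 0 = - 4"
        by (simp add: power2_eq_square power3_eq_cube)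
      ultimately show False by simp
    qed
    show ?thesis
    proof (rule subdegree_greaterI[OF ne])
      fix i assume "i \<le> n"
      thus "fps_nth (f k - 1) i = 0" unfolding eq using k
        by (simp add: fps_X_power_mult_nth)
    qed
  qed
  obtain P where P: "(\<lambda>n. \<Prod>k\<le>n. f k) \<longlonglongrightarrow> P"
    using tendsto_prod_fps[of f "\<lambda>n. n", OF nz sub] by blast
  have P0: "fps_nth P 0 = 1"
  proof -
    have "eventually (\<lambda>n. fps_nth (\<Prod>k\<le>n. f k) 0 = fps_nth P 0) sequentially"
      using P unfolding tendsto_fps_iff by blast
    moreover have "fps_nth (\<Prod>k\<le>n. f k) 0 = 1" for n
      by (induction n) (simp_all add: f0)
    ultimately show ?thesis by simp
  qed
  have "f has_prod P"
    using P P0 by (auto simp: has_prod_def raw_has_prod_def)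
  thus ?thesis
    using has_prod_unique[of f P] by (simp add: f_def)
qed

lemma c_coeff_sums:
  fixes q :: complex
  assumes q: "norm q < 1"
  shows "(\<lambda>m. of_int (c_coeff (m + 1)) * q ^ (m + 1)) sums
           (q * (\<Prod>k. (1 - q ^ (6 * (k + 1))) ^ 4))"
proof -
  define f :: "nat \<Rightarrow> int fps" where "f = (\<lambda>k. (1 - fps_X ^ (6 * (k + 1))) ^ 4)"
  define F :: "nat \<Rightarrow> complex fps" where "F = (\<lambda>k. (1 - fps_X ^ (6 * (k + 1))) ^ 4)"
  define g :: "nat \<Rightarrow> complex \<Rightarrow> complex" where "g = (\<lambda>k z. (1 - z ^ (6 * (k + 1))) ^ 4)"
  define H where "H = (\<lambda>z. \<Prod>k. g k z)"
  define h :: "int fps \<Rightarrow> complex fps" where "h = (\<lambda>A. Abs_fps (\<lambda>n. of_int (fps_nth A n)))"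
  define P where "P = prodinf f"
  obtain r where r: "norm q < r" "r < 1" using q dense by blast
  have r0: "r > 0" using r norm_ge_zero[of q] by linarith

  have h_mult: "h (A * B) = h A * h B" for A B
    by (rule fps_ext) (simp add: h_def fps_mult_nth)
  have h_1: "h 1 = 1" by (rule fps_ext) (simp add: h_def)
  have h_X: "h (1 - fps_X ^ n) = 1 - fps_X ^ n" for n
    by (rule fps_ext) (simp add: h_def fps_X_power_iff)
  have h_pow: "h (A ^ n) = h A ^ n" for A n
    by (induction n) (simp_all add: h_1 h_mult)
  have h_f: "h (f k) = F k" for k
    unfolding f_def F_def by (simp only: h_pow h_X)
  have h_prod: "h (\<Prod>k<n. f k) = (\<Prod>k<n. F k)" for n
    by (induction n) (simp_all add: h_1 h_mult h_f)

  have "f has_prod P"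
    using c_coeff_has_prod by (simp add: f_def P_def)
  hence "(\<lambda>n. \<Prod>k<n. f k) \<longlonglongrightarrow> P"
    by (rule has_prod_imp_tendsto')
  hence lim1: "(\<lambda>n. \<Prod>k<n. F k) \<longlonglongrightarrow> h P"
    unfolding tendsto_fps_iff h_prod [symmetric] by (auto simp: h_def elim!: eventually_mono)

  have bound: "norm (g k z - 1) \<le> 15 * r ^ k" if z: "norm z \<le> r" for k z
  proof -
    define w where "w = z ^ (6 * (k + 1))"
    have w: "norm w \<le> r ^ k"
    proof -
      have "norm w = norm z ^ (6 * (k + 1))" by (simp add: w_def norm_power)
      also have "\<dots> \<le> r ^ (6 * (k + 1))" by (rule power_mono) (use z in auto)
      also have "\<dots> \<le> r ^ k" by (rule power_decreasing) (use r r0 in auto)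
      finally show ?thesis .
    qed
    also have "r ^ k \<le> 1" using r r0 by (simp add: power_le_one)
    finally have w1: "norm w \<le> 1" .
    have "g k z - 1 = w * (- 4 + 6 * w - 4 * w ^ 2 + w ^ 3)"
      unfolding g_def w_def [symmetric] by algebra
    also have "norm \<dots> = norm w * norm (- 4 + 6 * w - 4 * w ^ 2 + w ^ 3)"
      by (rule norm_mult)
    also have "\<dots> \<le> r ^ k * 15"
    proof (rule mult_mono)
      have "norm (- 4 + 6 * w - 4 * w ^ 2 + w ^ 3) \<le>
              norm (- 4 :: complex) + norm (6 * w) + norm (4 * w ^ 2) + norm (w ^ 3)"
        by (intro order.trans[OF norm_triangle_ineq] order.trans[OF norm_triangle_ineq4]
              add_mono order.refl)
      also have "\<dots> = 4 + 6 * norm w + 4 * norm w ^ 2 + norm w ^ 3"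
        by (simp add: norm_mult norm_power)
      also have "\<dots> \<le> 4 + 6 * 1 + 4 * 1 + 1"
        using w1 by (intro add_mono mult_left_mono power_le_one) auto
      finally show "norm (- 4 + 6 * w - 4 * w ^ 2 + w ^ 3) \<le> 15" by simp
    qed (use w r0 in auto)
    finally show ?thesis by (simp add: mult_ac)
  qed
  have summ: "summable (\<lambda>k. 15 * r ^ k)"
    using r r0 by (intro summable_mult summable_geometric) auto

  have unif: "uniform_limit (cball 0 r) (\<lambda>n z. \<Prod>k<n. g k z) H sequentially"
  proof -
    have "uniformly_convergent_on (cball 0 r) (\<lambda>n z. \<Prod>k<n. g k z)"
    proof (rule uniformly_convergent_on_prod')
      show "uniformly_convergent_on (cball 0 r) (\<lambda>N x. \<Sum>n<N. norm (g n x - 1))"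
        by (rule Weierstrass_m_test'[OF _ summ]) (use bound in auto)
    qed (auto simp: g_def intro!: continuous_intros)
    then obtain l where l: "uniform_limit (cball 0 r) (\<lambda>n z. \<Prod>k<n. g k z) l sequentially"
      by (auto simp: uniformly_convergent_on_def)
    have "l z = H z" if z: "z \<in> cball 0 r" for z
    proof -
      have "summable (\<lambda>k. norm (g k z - 1))"
        by (rule summable_comparison_test'[OF summ]) (use bound z in auto)
      hence "convergent_prod (\<lambda>k. g k z)"
        by (intro abs_convergent_prod_imp_convergent_prod summable_imp_abs_convergent_prod)
      hence "(\<lambda>n. \<Prod>k<n. g k z) \<longlonglongrightarrow> H z"
        unfolding H_def by (intro has_prod_imp_tendsto' convergent_prod_has_prod)
      moreover have "(\<lambda>n. \<Prod>k<n. g k z) \<longlonglongrightarrow> l z"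
        by (rule tendsto_uniform_limitI[OF l z])
      ultimately show ?thesis using LIMSEQ_unique by blast
    qed
    with l show ?thesis
      using uniform_limit_cong'[of "cball 0 r" "\<lambda>n z. \<Prod>k<n. g k z" "\<lambda>n z. \<Prod>k<n. g k z" l H] by blast
  qed

  have holo: "H holomorphic_on ball 0 r"
  proof (rule holomorphic_uniform_limit[OF _ unif])
    show "eventually (\<lambda>n. continuous_on (cball 0 r) (\<lambda>z. \<Prod>k<n. g k z) \<and>
            (\<lambda>z. \<Prod>k<n. g k z) holomorphic_on ball 0 r) sequentially"
      by (auto simp: g_def intro!: always_eventually continuous_intros holomorphic_intros)
  qed auto

  have "fps_expansion H 0 = h P"
  proof (rule uniform_limit_imp_fps_expansion_eq[OF lim1])
    show "uniform_limit (ball 0 r) (\<lambda>n z. \<Prod>k<n. g k z) H sequentially"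
      by (rule uniform_limit_on_subset[OF unif]) auto
    show "eventually (\<lambda>n. (\<lambda>z. \<Prod>k<n. g k z) has_fps_expansion (\<Prod>k<n. F k)) sequentially"
      unfolding g_def F_def by (intro always_eventually allI fps_expansion_intros)
    show "H has_fps_expansion fps_expansion H 0"
      by (rule has_fps_expansion_fps_expansion[OF _ _ holo]) (use r0 in auto)
    show "eventually (\<lambda>n. (\<lambda>z. \<Prod>k<n. g k z) holomorphic_on ball 0 r) sequentially"
      unfolding g_def by (intro always_eventually allI holomorphic_intros)
  qed (use r0 in auto)
  hence coeff: "(deriv ^^ n) H 0 / fact n = of_int (fps_nth P n)" for n
    by (auto simp: fps_eq_iff fps_expansion_def h_def)

  have "(\<lambda>n. (deriv ^^ n) H 0 / fact n * (q - 0) ^ n) sums H q"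
    by (rule holomorphic_power_series[OF holo]) (use r in auto)
  hence "(\<lambda>n. of_int (fps_nth P n) * q ^ n) sums H q"
    by (simp add: coeff)
  hence "(\<lambda>n. q * (of_int (fps_nth P n) * q ^ n)) sums (q * H q)"
    by (rule sums_mult)
  moreover have "c_coeff (n + 1) = fps_nth P n" for n
    by (simp add: c_coeff_def P_def f_def)
  ultimately show ?thesis
    by (simp add: H_def g_def mult_ac)
qed

end

theory Submission
  imports Defs
begin

text \<open>
  Put \<open>M = 2 n + 3\<close>. Completing squares turns \<open>t(1, 1, 1, 9; n)\<close> into the number of representations
  of \<open>4 M\<close> as a sum of four odd squares the last of which is divisible by 3. All representations of
  \<open>4 M\<close> by four odd squares number \<open>16 \<sigma>(M)\<close>; this follows from a recurrence, which for \<open>\<sigma>\<close> comes from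
  Liouville-type involutions on the solutions of \<open>b^2 + 4 a c = 4 M + 1\<close>. Modulo 3 the number of
  coordinates divisible by 3 is fixed by \<open>M\<close>, which settles the residues 0 and 1 of \<open>n\<close> by symmetry.

  For \<open>n \<equiv> 2\<close> either none or exactly three coordinates are divisible by 3. By the pentagonal number
  theorem \<open>c(M)\<close> counts the representations by \<open>x\<^sub>i = 6 j\<^sub>i + 1\<close> with the sign \<open>(-1)^(j\<^sub>1 + \<dots> + j\<^sub>4)\<close>, and an
  orthogonal map sends those of negative sign to the representations of the second kind.
\<close>

section \<open>Sums of four odd squares\<close>

text \<open>
  A triple in this set encodes the indefinite form \<open>a X^2 + b X Y - c Y^2\<close> of discriminant \<open>K\<close>.
\<close>
definition forms :: "int \<Rightarrow> (int \<times> int \<times> int) set" where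
  "forms K = {(a, b, c). a > 0 \<and> c > 0 \<and> b ^ 2 + 4 * a * c = K}"

definition odd4 :: "int \<Rightarrow> (int \<times> int \<times> int \<times> int) set" where
  "odd4 N = {(x, y, z, w). odd x \<and> odd y \<and> odd z \<and> odd w \<and> x ^ 2 + y ^ 2 + z ^ 2 + w ^ 2 = N}"

section \<open>Squares of odd integers and finiteness of the solution sets\<close>

lemma abs_le_square: "\<bar>x\<bar> \<le> x ^ 2" for x :: int
proof (cases "x = 0")
  case False
  then have "\<bar>x\<bar> * 1 \<le> \<bar>x\<bar> * \<bar>x\<bar>" by (intro mult_left_mono) auto
  then show ?thesis by (simp add: power2_eq_square)
qed simp

lemma odd_square_mod_8: "odd x \<Longrightarrow> x ^ 2 mod 8 = 1" for x :: int
proof -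
  assume "odd x"
  then obtain t where t: "x = 2 * t + 1" by (elim oddE)
  have "even (t * (t + 1))" by simp
  then obtain s where "t * (t + 1) = 2 * s" by (elim evenE)
  then have "x ^ 2 = 8 * s + 1" unfolding t by (simp add: power2_eq_square algebra_simps)
  then show ?thesis by simp
qed

lemma odd_square_ge_1: "odd x \<Longrightarrow> x ^ 2 \<ge> 1" for x :: int
  by (auto simp: int_one_le_iff_zero_less)

lemma finite_forms [simp]: "finite (forms K)"
proof (rule finite_subset)
  show "forms K \<subseteq> {0..K} \<times> {-K..K} \<times> {0..K}"
  proof (clarsimp simp: forms_def)
    fix a b c :: int assume "a > 0" "c > 0"
    then have "a * 1 \<le> a * c" "1 * c \<le> a * c" by (auto intro: mult_left_mono mult_right_mono)
    with \<open>a > 0\<close> \<open>c > 0\<close> abs_le_square[of b]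
    show "a \<le> b\<^sup>2 + 4 * a * c \<and> - b\<^sup>2 - 4 * a * c \<le> b \<and> b \<le> b\<^sup>2 + 4 * a * c \<and> c \<le> b\<^sup>2 + 4 * a * c"
      using zero_le_power2[of b] by linarith
  qed
qed auto

lemma finite_odd4 [simp]: "finite (odd4 N)"
proof (rule finite_subset)
  show "odd4 N \<subseteq> {-N..N} \<times> {-N..N} \<times> {-N..N} \<times> {-N..N}"
  proof
    fix v assume "v \<in> odd4 N"
    then obtain x y z w where v: "v = (x, y, z, w)" and "x ^ 2 + y ^ 2 + z ^ 2 + w ^ 2 = N"
      by (auto simp: odd4_def)
    with abs_le_square[of x] abs_le_square[of y] abs_le_square[of z] abs_le_square[of w]
    show "v \<in> {-N..N} \<times> {-N..N} \<times> {-N..N} \<times> {-N..N}"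
      by (auto simp: abs_le_iff)
  qed
qed auto

text \<open>Since \<open>b ^ 2\<close> is 1 modulo 8, \<open>4 * a * c\<close> is 4 modulo 8. Hence
  \<open>a + b - c\<close> is odd, never zero, and the two regions of the reduction step cover all
  forms.\<close>

lemma forms_odd:
  assumes "K mod 8 = 5" "(a, b, c) \<in> forms K"
  shows "odd a" "odd b" "odd c"
proof -
  have K: "b ^ 2 + 4 * (a * c) = K" using assms by (auto simp: forms_def mult_ac)
  show b: "odd b"
  proof
    assume "even b"
    then have "even K" unfolding K[symmetric] by simp
    with assms(1) show False by presburger
  qed
  have "b ^ 2 mod 8 = 1" using b by (rule odd_square_mod_8)
  moreover have "odd r" if "s mod 8 = 1" "s + 4 * r = K" for r s :: int
    using that assms(1) by presburger
  ultimately have "odd (a * c)" using K by blast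
  then show "odd a" "odd c" by auto
qed

text \<open>
  Reduction step on forms: according to the sign of the value \<open>a + b - c\<close> at \<open>(1, 1)\<close>, replace \<open>(X, Y)\<close>
  by \<open>(X + Y, Y)\<close> or \<open>(X, X + Y)\<close> and then negate the middle coefficient. Both maps are involutions
  of their regions. The polynomials \<open>h\<close> and \<open>h'\<close> are chosen such that their increments under these two
  maps are the same polynomial \<open>p\<close>, whose part even in \<open>b\<close> is \<open>- 3 (a + c) (a c - b^2)\<close>.
\<close>
lemma sum_forms_eq_0:
  assumes K: "K mod 8 = 5"
  shows "(\<Sum>(a, b, c)\<in>forms K. (a * c - b ^ 2) * a) = 0"
proof -
  define p :: "int \<times> int \<times> int \<Rightarrow> int" where
    "p = (\<lambda>(a, b, c). 3 * (a^2 * b - a^2 * c + a * b^2 - a * c^2 + b^2 * c - b * c^2))"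
  define h :: "int \<times> int \<times> int \<Rightarrow> int" where
    "h = (\<lambda>(a, b, c). c * (4 * a^2 + a * c - b^2 + c^2))"
  define h' :: "int \<times> int \<times> int \<Rightarrow> int" where
    "h' = (\<lambda>(a, b, c). a * (4 * c^2 + a * c - b^2 + a^2))"
  define \<tau> :: "int \<times> int \<times> int \<Rightarrow> int \<times> int \<times> int" where
    "\<tau> = (\<lambda>(a, b, c). (a, - (b + 2 * a), c - a - b))"
  define \<rho> :: "int \<times> int \<times> int \<Rightarrow> int \<times> int \<times> int" where
    "\<rho> = (\<lambda>(a, b, c). (a + b - c, 2 * c - b, c))"
  define L where "L = {(a, b, c) \<in> forms K. a + b < c}"
  define G where "G = {(a, b, c) \<in> forms K. a + b > c}"
  have LG: "forms K = L \<union> G" "L \<inter> G = {}"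
  proof -
    have "a + b \<noteq> c" if "(a, b, c) \<in> forms K" for a b c
      using forms_odd[OF K that] by presburger
    then show "forms K = L \<union> G" by (force simp: L_def G_def)
  qed (auto simp: L_def G_def)
  have fin: "finite L" "finite G" using finite_forms[of K] unfolding LG by auto
  have "sum h L = sum (\<lambda>v. h (\<tau> v)) L"
    by (rule sum.reindex_bij_witness[of _ \<tau> \<tau>])
       (auto simp: L_def \<tau>_def forms_def power2_eq_square algebra_simps)
  moreover have "h (\<tau> v) - h v = p v" for v
    by (cases v) (simp add: h_def \<tau>_def p_def power2_eq_square algebra_simps)
  ultimately have "sum p L = 0" using sum_subtractf[of "\<lambda>v. h (\<tau> v)" h L] by simp
  have "sum h' G = sum (\<lambda>v. h' (\<rho> v)) G"
    by (rule sum.reindex_bij_witness[of _ \<rho> \<rho>])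
       (auto simp: G_def \<rho>_def forms_def power2_eq_square algebra_simps)
  moreover have "h' (\<rho> v) - h' v = p v" for v
    by (cases v) (simp add: h'_def \<rho>_def p_def power2_eq_square algebra_simps)
  ultimately have "sum p G = 0" using sum_subtractf[of "\<lambda>v. h' (\<rho> v)" h' G] by simp
  with \<open>sum p L = 0\<close> have p0: "sum p (forms K) = 0"
    using fin LG by (simp add: sum.union_disjoint)
  define e :: "int \<times> int \<times> int \<Rightarrow> int" where "e = (\<lambda>(a, b, c). (a * c - b ^ 2) * a)"
  have "sum p (forms K) = (\<Sum>(a, b, c)\<in>forms K. p (a, - b, c))"
    by (rule sum.reindex_bij_witness[of _ "\<lambda>(a, b, c). (a, - b, c)" "\<lambda>(a, b, c). (a, - b, c)"])
       (auto simp: forms_def)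
  moreover have e_swap: "sum e (forms K) = (\<Sum>(a, b, c)\<in>forms K. e (c, b, a))"
    by (rule sum.reindex_bij_witness[of _ "\<lambda>(a, b, c). (c, b, a)" "\<lambda>(a, b, c). (c, b, a)"])
       (auto simp: forms_def)
  \<comment> \<open>\<open>p\<close> is symmetrised under negating \<open>b\<close>, and
    \<open>e\<close> under exchanging \<open>a\<close> and \<open>c\<close>; with these factors the
    combined summand vanishes pointwise.\<close>
  ultimately have "2 * sum p (forms K) + 12 * sum e (forms K) =
      sum p (forms K) + (\<Sum>(a, b, c)\<in>forms K. p (a, - b, c))
       + 6 * sum e (forms K) + 6 * (\<Sum>(a, b, c)\<in>forms K. e (c, b, a))" by simp
  also have "\<dots> = (\<Sum>(a, b, c)\<in>forms K.
       p (a, b, c) + p (a, - b, c) + 6 * e (a, b, c) + 6 * e (c, b, a))"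
    by (simp add: sum.distrib sum_distrib_left case_prod_unfold)
  also have "\<dots> = 0"
    by (rule sum.neutral) (auto simp: p_def e_def power2_eq_square algebra_simps)
  finally show ?thesis using p0 by (simp add: e_def)
qed

text \<open>The index set of both recurrences: for \<open>K\<close> congruent to 5 modulo 8, every
  such \<open>b\<close> makes \<open>K - b ^ 2\<close> four times a positive odd integer.\<close>

definition odd_sqrt_below :: "int \<Rightarrow> int set" where
  "odd_sqrt_below K = {b. odd b \<and> b ^ 2 < K}"

lemma finite_odd_sqrt_below [simp]: "finite (odd_sqrt_below K)"
proof (rule finite_subset)
  show "odd_sqrt_below K \<subseteq> {-K..K}"
  proof
    fix b assume "b \<in> odd_sqrt_below K"
    with abs_le_square[of b] show "b \<in> {-K..K}" by (auto simp: odd_sqrt_below_def)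
  qed
qed simp

text \<open>
  Together with \<open>sum_card_odd4_eq_0\<close> this says that \<open>16 \<sigma>(M)\<close> and the number of representations of
  \<open>4 M\<close> satisfy the same recurrence; with \<open>K = 4 M + 1\<close> the terms \<open>b = \<plusminus> 1\<close> are the ones at \<open>M\<close> itself.
\<close>
lemma sum_sigma_eq_0:
  assumes K: "K mod 8 = 5"
  shows "(\<Sum>b\<in>odd_sqrt_below K. (K - 5 * b ^ 2) * (\<Sum>d | d dvd nat ((K - b ^ 2) div 4). int d)) = 0"
proof -
  define m where "m b = nat ((K - b ^ 2) div 4)" for b
  have m: "K - b ^ 2 = 4 * int (m b)" "m b > 0" if "b \<in> odd_sqrt_below K" for b
  proof -
    have "b ^ 2 mod 8 = 1" "b ^ 2 < K" using that odd_square_mod_8 by (auto simp: odd_sqrt_below_def)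
    with K have "4 dvd K - b ^ 2" "K - b ^ 2 > 0" by presburger+
    then show "K - b ^ 2 = 4 * int (m b)" "m b > 0" unfolding m_def by auto
  qed
  have "(\<Sum>b\<in>odd_sqrt_below K. (K - 5 * b ^ 2) * (\<Sum>d | d dvd m b. int d)) =
        (\<Sum>b\<in>odd_sqrt_below K. \<Sum>d | d dvd m b. (K - 5 * b ^ 2) * int d)"
    by (simp add: sum_distrib_left)
  also have "\<dots> = (\<Sum>(b, d)\<in>Sigma (odd_sqrt_below K) (\<lambda>b. {d. d dvd m b}). (K - 5 * b ^ 2) * int d)"
    by (rule sum.Sigma) (use m in \<open>auto simp: finite_divisors_nat\<close>)
  \<comment> \<open>A divisor \<open>d\<close> of \<open>m b\<close> is the leading coefficient of
    exactly one form with middle coefficient \<open>b\<close>; the complementary divisor is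
    \<open>c\<close>.\<close>
  also have "\<dots> = (\<Sum>(a, b, c)\<in>forms K. (K - 5 * b ^ 2) * a)"
  proof -
    have A: "b \<in> odd_sqrt_below K" "nat a dvd m b" "int (m b div nat a) = c" "a \<ge> 0"
      if f: "(a, b, c) \<in> forms K" for a b c
    proof -
      show b: "b \<in> odd_sqrt_below K" using forms_odd[OF K f] f by (auto simp: odd_sqrt_below_def forms_def)
      have "a > 0" using f by (auto simp: forms_def)
      then show "a \<ge> 0" by simp
      have "c > 0" "int (m b) = a * c" using m[OF b] f by (auto simp: forms_def)
      then have "m b = nat a * nat c"
        by (metis nat_int nat_mult_distrib order_less_imp_le \<open>a > 0\<close>)
      with \<open>a > 0\<close> \<open>c > 0\<close> show "nat a dvd m b" "int (m b div nat a) = c" by simp_all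
    qed
    have B: "(int d, b, int (m b div d)) \<in> forms K" if b: "b \<in> odd_sqrt_below K" and d: "d dvd m b" for b d
    proof -
      obtain e where e: "m b = d * e" using d by (elim dvdE)
      with m(2)[OF b] have "d > 0" "e > 0" by auto
      with m(1)[OF b] e show ?thesis by (auto simp: forms_def)
    qed
    show ?thesis
      by (rule sum.reindex_bij_witness[of _ "\<lambda>(a, b, c). (b, nat a)"
            "\<lambda>(b, d). (int d, b, int (m b div d))"]) (use A B in auto)
  qed
  also have "\<dots> = (\<Sum>(a, b, c)\<in>forms K. 4 * ((a * c - b ^ 2) * a))"
    by (rule sum.cong) (auto simp: forms_def algebra_simps)
  also have "\<dots> = 0"
    using sum_forms_eq_0[OF K] by (simp add: case_prod_unfold flip: sum_distrib_left)
  finally show ?thesis by (simp add: m_def)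
qed

text \<open>With \<open>b\<close> adjoined, the representations become those of \<open>K\<close> by
  five odd squares. There \<open>K - 5 * b ^ 2\<close> splits into four differences such as
  \<open>x^2 - b^2\<close>, and each sums to zero because exchanging \<open>b\<close> with that
  coordinate permutes the solutions.\<close>

lemma sum_card_odd4_eq_0:
  "(\<Sum>b\<in>odd_sqrt_below K. (K - 5 * b ^ 2) * int (card (odd4 (K - b ^ 2)))) = 0"
proof -
  define V where "V = Sigma (odd_sqrt_below K) (\<lambda>b. odd4 (K - b ^ 2))"
  have V: "(b, x, y, z, w) \<in> V \<longleftrightarrow> odd b \<and> odd x \<and> odd y \<and> odd z \<and> odd w \<and>
      b^2 + x^2 + y^2 + z^2 + w^2 = K" for b x y z w
    proof -
    have "b ^ 2 < b^2 + x^2 + y^2 + z^2 + w^2" if "odd x"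
      using odd_square_ge_1[OF that] zero_le_power2[of y] zero_le_power2[of z] zero_le_power2[of w]
      by linarith
    then show ?thesis by (auto simp: V_def odd_sqrt_below_def odd4_def)
  qed
  have "(\<Sum>b\<in>odd_sqrt_below K. (K - 5 * b ^ 2) * int (card (odd4 (K - b ^ 2)))) =
        (\<Sum>b\<in>odd_sqrt_below K. \<Sum>v\<in>odd4 (K - b ^ 2). K - 5 * b ^ 2)" by (simp add: mult.commute)
  also have "\<dots> = (\<Sum>(b, v)\<in>V. K - 5 * b ^ 2)"
    unfolding V_def by (rule sum.Sigma) auto
  also have "\<dots> = (\<Sum>(b, x, y, z, w)\<in>V. (x^2 - b^2) + (y^2 - b^2) + (z^2 - b^2) + (w^2 - b^2))"
    by (rule sum.cong) (auto simp: V)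
  also have "\<dots> = (\<Sum>(b, x, y, z, w)\<in>V. x^2 - b^2) + (\<Sum>(b, x, y, z, w)\<in>V. y^2 - b^2)
     + (\<Sum>(b, x, y, z, w)\<in>V. z^2 - b^2) + (\<Sum>(b, x, y, z, w)\<in>V. w^2 - b^2)"
    by (simp only: case_prod_unfold sum.distrib)
  also have "(\<Sum>(b, x, y, z, w)\<in>V. x^2 - b^2) = 0"
  proof -
    have "(\<Sum>(b, x, y, z, w)\<in>V. x^2) = (\<Sum>(b, x, y, z, w)\<in>V. b^2)"
      by (rule sum.reindex_bij_witness[of _ "\<lambda>(b, x, y, z, w). (x, b, y, z, w)" "\<lambda>(b, x, y, z, w). (x, b, y, z, w)"])
         (auto simp: V)
    then show ?thesis by (simp add: case_prod_unfold sum_subtractf)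
  qed
  also have "(\<Sum>(b, x, y, z, w)\<in>V. y^2 - b^2) = 0"
  proof -
    have "(\<Sum>(b, x, y, z, w)\<in>V. y^2) = (\<Sum>(b, x, y, z, w)\<in>V. b^2)"
      by (rule sum.reindex_bij_witness[of _ "\<lambda>(b, x, y, z, w). (y, x, b, z, w)" "\<lambda>(b, x, y, z, w). (y, x, b, z, w)"])
         (auto simp: V)
    then show ?thesis by (simp add: case_prod_unfold sum_subtractf)
  qed
  also have "(\<Sum>(b, x, y, z, w)\<in>V. z^2 - b^2) = 0"
  proof -
    have "(\<Sum>(b, x, y, z, w)\<in>V. z^2) = (\<Sum>(b, x, y, z, w)\<in>V. b^2)"
      by (rule sum.reindex_bij_witness[of _ "\<lambda>(b, x, y, z, w). (z, x, y, b, w)" "\<lambda>(b, x, y, z, w). (z, x, y, b, w)"])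
         (auto simp: V)
    then show ?thesis by (simp add: case_prod_unfold sum_subtractf)
  qed
  also have "(\<Sum>(b, x, y, z, w)\<in>V. w^2 - b^2) = 0"
  proof -
    have "(\<Sum>(b, x, y, z, w)\<in>V. w^2) = (\<Sum>(b, x, y, z, w)\<in>V. b^2)"
      by (rule sum.reindex_bij_witness[of _ "\<lambda>(b, x, y, z, w). (w, x, y, z, b)" "\<lambda>(b, x, y, z, w). (w, x, y, z, b)"])
         (auto simp: V)
    then show ?thesis by (simp add: case_prod_unfold sum_subtractf)
  qed
  finally show ?thesis by simp
qed

lemma odd4_4: "odd4 4 = {-1, 1} \<times> {-1, 1} \<times> {-1, 1} \<times> {-1, 1}"
proof (intro equalityI subsetI)
  fix v assume "v \<in> odd4 4"
  then obtain x y z w where v: "v = (x, y, z, w)" and o: "odd x" "odd y" "odd z" "odd w"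
    and "x^2 + y^2 + z^2 + w^2 = 4" by (auto simp: odd4_def)
  with o[THEN odd_square_ge_1] have "x^2 = 1" "y^2 = 1" "z^2 = 1" "w^2 = 1" by linarith+
  then show "v \<in> {-1, 1} \<times> {-1, 1} \<times> {-1, 1} \<times> {-1, 1}"
    unfolding v power2_eq_1_iff mem_Times_iff fst_conv snd_conv by blast
qed (auto simp: odd4_def)

lemma card_odd4:
  assumes "odd M"
  shows "card (odd4 (4 * int M)) = 16 * (\<Sum>d | d dvd M. d)"
  using assms
proof (induction M rule: less_induct)
  case (less M)
  show ?case
  \<comment> \<open>The recurrence determines the value at \<open>M\<close> only up to the factor
    \<open>4 * M - 4\<close>, so \<open>M = 1\<close> is counted directly.\<close>
  proof (cases "M = 1")
    case True
    then show ?thesis by (simp add: odd4_4)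
  next
    case False
    define K where "K = 4 * int M + 1"
    define D where "D m = int (card (odd4 (4 * int m))) - 16 * (\<Sum>d | d dvd m. int d)" for m
    have K: "K mod 8 = 5" using \<open>odd M\<close> unfolding K_def by presburger
    have 1: "K - b ^ 2 = 4 * int (nat ((K - b ^ 2) div 4))" "odd (nat ((K - b ^ 2) div 4))"
      if "b \<in> odd_sqrt_below K" for b
    proof -
      have "b ^ 2 mod 8 = 1" "b ^ 2 < K" using that odd_square_mod_8 by (auto simp: odd_sqrt_below_def)
      with K obtain t where t: "K - b ^ 2 = 4 * (2 * t + 1)" and "t \<ge> 0"
        by (intro that[of "(K - b ^ 2 - 4) div 8"]; presburger)
      from t \<open>t \<ge> 0\<close> show "K - b ^ 2 = 4 * int (nat ((K - b ^ 2) div 4))" by simp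
      from \<open>t \<ge> 0\<close> show "odd (nat ((K - b ^ 2) div 4))" unfolding t by (simp add: even_nat_iff)
    qed
    have "(\<Sum>b\<in>odd_sqrt_below K. (K - 5 * b ^ 2) * D (nat ((K - b ^ 2) div 4))) =
      (\<Sum>b\<in>odd_sqrt_below K. (K - 5 * b ^ 2) * int (card (odd4 (K - b ^ 2)))) - 16 *
      (\<Sum>b\<in>odd_sqrt_below K. (K - 5 * b ^ 2) * (\<Sum>d | d dvd nat ((K - b ^ 2) div 4). int d))"
      unfolding D_def sum_distrib_left sum_subtractf[symmetric]
      by (rule sum.cong) (simp_all add: 1(1)[symmetric] right_diff_distrib sum_distrib_left mult_ac del: nat_div_as_int int_nat_eq)
    also have "\<dots> = 0" by (simp add: sum_sigma_eq_0[OF K] sum_card_odd4_eq_0)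
    finally have "0 = (\<Sum>b\<in>odd_sqrt_below K. (K - 5 * b ^ 2) * D (nat ((K - b ^ 2) div 4)))" ..
    \<comment> \<open>If \<open>b ^ 2 > 1\<close>, the argument of \<open>D\<close> is smaller than
      \<open>M\<close>, and the induction hypothesis kills the term.\<close>
    also have "\<dots> = (\<Sum>b\<in>{-1, 1}. (K - 5 * b ^ 2) * D (nat ((K - b ^ 2) div 4)))"
    proof (rule sum.mono_neutral_right)
      show "{-1, 1} \<subseteq> odd_sqrt_below K" using odd_pos[OF \<open>odd M\<close>] by (auto simp: odd_sqrt_below_def K_def)
      show "\<forall>b\<in>odd_sqrt_below K - {-1, 1}. (K - 5 * b ^ 2) * D (nat ((K - b ^ 2) div 4)) = 0"
      proof
        fix b assume b: "b \<in> odd_sqrt_below K - {-1, 1}"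
        then have "b ^ 2 \<noteq> 1" "odd b" by (auto simp: power2_eq_1_iff odd_sqrt_below_def)
        with odd_square_ge_1[of b] have "b ^ 2 > 1" by linarith
        moreover have "4 * int M + 1 - b ^ 2 = 4 * int (nat ((K - b ^ 2) div 4))"
          using 1(1)[of b] b by (simp only: K_def Diff_iff)
        ultimately have less: "nat ((K - b ^ 2) div 4) < M" by linarith
        from less.IH[OF less 1(2)] b have "D (nat ((K - b ^ 2) div 4)) = 0"
          by (simp add: D_def)
        then show "(K - 5 * b ^ 2) * D (nat ((K - b ^ 2) div 4)) = 0" by simp
      qed
    qed simp
    also have "\<dots> = 2 * (4 * int M - 4) * D M" by (simp add: K_def)
    finally have "D M = 0" using False by simp
    then show ?thesis unfolding D_def by (simp flip: of_nat_sum of_nat_mult)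
  qed
qed

section \<open>The pentagonal number theorem and the coefficients c\<close>

text \<open>The generalized pentagonal numbers, indexed by all integers. The form with
  \<open>+ 1\<close> makes \<open>24 * pent j + 1\<close> the square of
  \<open>6 * j + 1\<close>.\<close>

definition pent :: "int \<Rightarrow> int" where
  "pent j = j * (3 * j + 1) div 2"

text \<open>The power \<open>(-1) ^ j\<close> for exponents \<open>j\<close> that may be
  negative.\<close>

definition parity_sign :: "int \<Rightarrow> 'a::comm_ring_1" where
  "parity_sign j = (if even j then 1 else - 1)"

definition pent4 :: "nat \<Rightarrow> (int \<times> int \<times> int \<times> int) set" where
  "pent4 m = {(a, b, c, d). pent a + pent b + pent c + pent d = int m}"

lemma two_pent: "2 * pent j = j * (3 * j + 1)"
  by (simp add: pent_def)

lemma abs_le_pent: "\<bar>j\<bar> \<le> pent j"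
proof -
  have "2 * pent j = 3 * j ^ 2 + j"
    unfolding two_pent by (simp add: power2_eq_square algebra_simps)
  with abs_le_square[of j] show ?thesis by linarith
qed

lemma pent_nonneg: "pent j \<ge> 0"
  using abs_le_pent[of j] by linarith

lemma pent4_subset:
  assumes "m \<le> n"
  shows "pent4 m \<subseteq> {- int n..int n} \<times> {- int n..int n} \<times> {- int n..int n} \<times> {- int n..int n}"
    (is "_ \<subseteq> ?I \<times> _")
proof
  fix v assume "v \<in> pent4 m"
  then obtain a b c d where v: "v = (a, b, c, d)" and "pent a + pent b + pent c + pent d = int m"
    by (auto simp: pent4_def)
  with abs_le_pent[of a] abs_le_pent[of b] abs_le_pent[of c] abs_le_pent[of d] assms
  have "\<bar>a\<bar> \<le> int n" "\<bar>b\<bar> \<le> int n" "\<bar>c\<bar> \<le> int n" "\<bar>d\<bar> \<le> int n" by linarith+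
  then show "v \<in> ?I \<times> ?I \<times> ?I \<times> ?I" by (auto simp: v)
qed

lemma finite_pent4: "finite (pent4 m)"
  using pent4_subset[of m m] by (rule finite_subset) auto

text \<open>This and its companion for negative indices bring the two outermost pentagonal exponents
  into the shape \<open>s * n + s * (s + 1) div 2\<close> of Shanks' sum.\<close>

lemma nat_pent_pos: "nat (pent (int m)) = m * m + m * (m + 1) div 2"
proof -
  have "2 * (m * (m + 1) div 2) = m * (m + 1)" by simp
  then have "2 * int (m * (m + 1) div 2) = int m * (int m + 1)" by (metis of_nat_mult of_nat_numeral of_nat_add of_nat_1)
  with two_pent[of "int m"] have "pent (int m) = int (m * m + m * (m + 1) div 2)"
    by (simp add: algebra_simps)
  then show ?thesis by (simp only: nat_int)
qed

lemma nat_pent_neg: "nat (pent (- int (Suc n))) = Suc n * n + Suc n * (Suc n + 1) div 2"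
proof -
  have "2 * (Suc n * (Suc n + 1) div 2) = Suc n * (Suc n + 1)" by simp
  then have "2 * int (Suc n * (Suc n + 1) div 2) = int (Suc n) * (int (Suc n) + 1)"
    by (metis of_nat_mult of_nat_numeral of_nat_add of_nat_1)
  with two_pent[of "- int (Suc n)"]
  have "pent (- int (Suc n)) = int (Suc n * n + Suc n * (Suc n + 1) div 2)"
    by (simp add: algebra_simps del: of_nat_Suc) (simp add: algebra_simps)
  then show ?thesis by (simp only: nat_int)
qed

text \<open>Shanks' finite form of the pentagonal number theorem; on the right, only \<open>s = 0\<close> survives modulo \<open>q^(n + 1)\<close>.\<close>
lemma shanks_pentagonal:
  fixes q :: "'a::comm_ring_1"
  shows "(\<Sum>j = - int n..int n. parity_sign j * q ^ nat (pent j)) =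
    (\<Sum>s\<le>n. (-1) ^ s * (\<Prod>i = Suc s..n. 1 - q ^ i) * q ^ (s * n + s * (s + 1) div 2))"
proof (induction n)
  case 0
  show ?case by (simp add: parity_sign_def pent_def)
next
  case (Suc n)
  define T where "T s = s * (s + 1) div 2" for s :: nat
  define P where "P s n = (\<Prod>i = Suc s..n. 1 - q ^ i)" for s n
  define t where "t n s = (-1) ^ s * P s n * q ^ (s * n + T s)" for s n
  \<comment> \<open>A telescoping certificate: passing from \<open>n\<close> to \<open>n + 1\<close>
    changes the term at \<open>s\<close> by \<open>v s - v (Suc s)\<close>. The value 0 at
    \<open>s = 0\<close> removes the lower boundary.\<close>
  define v where "v s = (case s of 0 \<Rightarrow> 0 | Suc r \<Rightarrow> (-1) ^ r * P r n * q ^ (s * n + T s))" for s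
  have T: "T (Suc s) = T s + s + 1" for s by (simp add: T_def)
  have P_Suc: "P s (Suc n) = P s n * (1 - q ^ Suc n)" if "s \<le> n" for s
    using that by (simp add: P_def)
  have P_left: "P r n = (1 - q ^ Suc r) * P (Suc r) n" if "Suc r \<le> n" for r
    using that by (simp add: P_def prod.atLeast_Suc_atMost)
  have step: "t (Suc n) s - t n s = v s - v (Suc s)" if "s \<le> n" for s
  proof (cases s)
    case 0
    then show ?thesis using that by (simp add: t_def v_def P_Suc T T_def algebra_simps)
  next
    case (Suc r)
    have "v s = - ((-1) ^ s) * ((1 - q ^ s) * P s n) * q ^ (s * n + T s)"
      using that Suc P_left[of r] by (simp add: v_def)
    moreover have "v (Suc s) = (-1) ^ s * P s n * q ^ (s * n + T s + s + Suc n)"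
      by (simp add: v_def T algebra_simps)
    moreover have "t (Suc n) s = (-1) ^ s * (P s n * (1 - q ^ Suc n)) * q ^ (s * n + T s + s)"
      using that by (simp add: t_def P_Suc algebra_simps)
    ultimately show ?thesis by (simp add: t_def power_add algebra_simps)
  qed
  \<comment> \<open>Of the two new indices, \<open>n + 1\<close> supplies the new term
    \<open>s = n + 1\<close>, and \<open>- (n + 1)\<close> the boundary \<open>- v (Suc n)\<close>
    of the telescoping sum.\<close>
  have "(\<Sum>j = - int (Suc n)..int (Suc n). parity_sign j * q ^ nat (pent j)) =
        (\<Sum>j\<in>insert (- int (Suc n)) (insert (int (Suc n)) {- int n..int n}). parity_sign j * q ^ nat (pent j))"
    by (rule sum.cong) auto
  also have "\<dots> = parity_sign (- int (Suc n)) * q ^ nat (pent (- int (Suc n))) +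
      (parity_sign (int (Suc n)) * q ^ nat (pent (int (Suc n))) + (\<Sum>s\<le>n. t n s))"
    unfolding t_def P_def T_def Suc.IH[symmetric]
    by (subst sum.insert; (subst sum.insert)?; simp)
  also have "parity_sign (- int (Suc n)) * q ^ nat (pent (- int (Suc n))) = - v (Suc n)"
    unfolding nat_pent_neg by (simp add: v_def parity_sign_def T_def P_def)
  also have "- v (Suc n) = (\<Sum>s\<le>n. v s - v (Suc s))"
    by (subst sum_telescope) (simp add: v_def)
  also have "\<dots> = (\<Sum>s\<le>n. t (Suc n) s - t n s)"
    by (rule sum.cong) (simp_all add: step)
  also have "parity_sign (int (Suc n)) * q ^ nat (pent (int (Suc n))) = t (Suc n) (Suc n)"
    unfolding nat_pent_pos by (simp add: t_def P_def T_def parity_sign_def)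
  finally show ?case by (simp add: sum_subtractf t_def P_def T_def)
qed

text \<open>The term \<open>s = 0\<close> of Shanks' sum is the full product; all others have
  exponent at least \<open>n + 1\<close>. Divisibility in an arbitrary ring permits the substitution
  of \<open>fps_X ^ 6\<close> for \<open>q\<close>.\<close>

lemma pentagonal_dvd:
  fixes q :: "'a::comm_ring_1"
  shows "q ^ Suc n dvd (\<Prod>i = Suc 0..n. 1 - q ^ i) - (\<Sum>j = - int n..int n. parity_sign j * q ^ nat (pent j))"
proof -
  define t where "t s = (-1) ^ s * (\<Prod>i = Suc s..n. 1 - q ^ i) * q ^ (s * n + s * (s + 1) div 2)" for s
  have "q ^ Suc n dvd t s" if "s \<in> {Suc 0..n}" for s
  proof -
    have "1 * n \<le> s * n" using that by (intro mult_right_mono) auto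
    moreover have "s * (s + 1) div 2 \<ge> 1" using that by (cases s) auto
    ultimately have "Suc n \<le> s * n + s * (s + 1) div 2" by linarith
    then show ?thesis unfolding t_def by (intro dvd_mult le_imp_power_dvd)
  qed
  then have "q ^ Suc n dvd (\<Sum>s = Suc 0..n. t s)" by (rule dvd_sum)
  moreover have "(\<Sum>s\<le>n. t s) = t 0 + (\<Sum>s = Suc 0..n. t s)"
    by (simp add: atMost_atLeast0 sum.atLeast_Suc_atMost)
  ultimately show ?thesis unfolding shanks_pentagonal t_def[symmetric] by (simp add: t_def[of 0])
qed

text \<open>Expanding the fourth power gives one monomial per quadruple of indices. As
  \<open>pent j\<close> is at least the absolute value of \<open>j\<close>, truncation at
  \<open>n \<ge> m\<close> loses no quadruple of \<open>pent4 m\<close>.\<close>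

lemma fps_nth_pentagonal_power4:
  assumes "m \<le> n"
  shows "fps_nth ((\<Sum>j = - int n..int n. parity_sign j * (fps_X ^ 6) ^ nat (pent j)) ^ 4 :: int fps) (6 * m) =
    (\<Sum>(a, b, c, d)\<in>pent4 m. parity_sign (a + b + c + d))"
proof -
  define I where "I = {- int n..int n}"
  define f :: "int \<Rightarrow> int fps" where "f j = parity_sign j * (fps_X ^ 6) ^ nat (pent j)" for j
  have f: "f j = fps_const (parity_sign j) * fps_X ^ (6 * nat (pent j))" for j
    by (simp add: f_def parity_sign_def power_mult flip: fps_const_neg)
  have prod: "sum g A * sum h B = (\<Sum>(a, b)\<in>A \<times> B. g a * h b :: int fps)"
    for g h and A :: "int set" and B :: "'b set"
    by (simp add: sum_product sum.cartesian_product)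
  have "sum f I ^ 4 = sum f I * (sum f I * (sum f I * sum f I))"
    by (simp add: eval_nat_numeral)
  also have "\<dots> = (\<Sum>(a, b, c, d)\<in>I \<times> I \<times> I \<times> I. f a * (f b * (f c * f d)))"
    by (simp only: prod case_prod_unfold)
  also have "fps_nth \<dots> (6 * m) = (\<Sum>v\<in>I \<times> I \<times> I \<times> I.
      if v \<in> pent4 m then (case v of (a, b, c, d) \<Rightarrow> parity_sign (a + b + c + d)) else 0)"
    unfolding fps_sum_nth
  proof (rule sum.cong)
    fix v :: "int \<times> int \<times> int \<times> int"
    obtain a b c d where v: "v = (a, b, c, d)" by (cases v)
    have "f a * (f b * (f c * f d)) = fps_const (parity_sign (a + b + c + d)) *
        fps_X ^ (6 * (nat (pent a) + nat (pent b) + nat (pent c) + nat (pent d)))"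
      unfolding f by (simp add: power_add algebra_simps parity_sign_def flip: fps_const_neg)
    then show "fps_nth (case v of (a, b, c, d) \<Rightarrow> f a * (f b * (f c * f d))) (6 * m) =
        (if v \<in> pent4 m then (case v of (a, b, c, d) \<Rightarrow> parity_sign (a + b + c + d)) else 0)"
      using pent_nonneg[of a] pent_nonneg[of b] pent_nonneg[of c] pent_nonneg[of d]
      by (auto simp: v pent4_def fps_X_power_iff)
  qed simp
  also have "\<dots> = (\<Sum>(a, b, c, d)\<in>pent4 m. parity_sign (a + b + c + d))"
  proof (subst sum.inter_restrict[symmetric])
    have "pent4 m \<subseteq> I \<times> I \<times> I \<times> I" unfolding I_def by (rule pent4_subset[OF assms])
    then have "I \<times> I \<times> I \<times> I \<inter> pent4 m = pent4 m" by blast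
    then show "(\<Sum>v\<in>I \<times> I \<times> I \<times> I \<inter> pent4 m. case v of (a, b, c, d) \<Rightarrow> parity_sign (a + b + c + d)) =
      (\<Sum>(a, b, c, d)\<in>pent4 m. parity_sign (a + b + c + d))" by simp
  qed (simp add: I_def)
  finally show ?thesis by (simp add: f_def[abs_def] I_def)
qed

text \<open>The shift by 1 comes from the factor \<open>fps_X\<close>. A suitable partial product
  has the same coefficient as the infinite one and agrees with the fourth power of the truncated
  pentagonal series modulo \<open>fps_X ^ (6 * (n + 1))\<close>.\<close>

lemma c_coeff_eq:
  "c_coeff (6 * m + 1) = (\<Sum>(a, b, c, d)\<in>pent4 m. parity_sign (a + b + c + d))"
proof -
  define f :: "nat \<Rightarrow> int fps" where "f = (\<lambda>k. (1 - fps_X ^ (6 * (k + 1))) ^ 4)"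
  have "(\<lambda>n. \<Prod>k<n. f k) \<longlonglongrightarrow> prodinf f"
    using c_coeff_has_prod unfolding f_def by (rule has_prod_imp_tendsto')
  then have "eventually (\<lambda>n. fps_nth (\<Prod>k<n. f k) (6 * m) = fps_nth (prodinf f) (6 * m)) sequentially"
    unfolding tendsto_fps_iff by blast
  then obtain n where "n \<ge> m" and n: "fps_nth (\<Prod>k<n. f k) (6 * m) = fps_nth (prodinf f) (6 * m)"
    unfolding eventually_sequentially by (metis nle_le)
  define q :: "int fps" where "q = fps_X ^ 6"
  define A where "A = (\<Prod>i = Suc 0..n. 1 - q ^ i)"
  define B where "B = (\<Sum>j = - int n..int n. parity_sign j * q ^ nat (pent j))"
  have "(\<Prod>k<n. f k) = A ^ 4"
    unfolding A_def prod.atLeast1_atMost_eq prod_power_distrib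
    by (rule prod.cong) (simp_all only: f_def q_def power_mult Suc_eq_plus1)
  moreover have "q ^ Suc n dvd A - B" unfolding A_def B_def by (rule pentagonal_dvd)
  \<comment> \<open>The factor \<open>A - B\<close> carries the divisibility over to the fourth
    powers.\<close>
  moreover have "A ^ 4 - B ^ 4 = (A - B) * (A ^ 3 + A ^ 2 * B + A * B ^ 2 + B ^ 3)" by algebra
  ultimately obtain E where E: "(\<Prod>k<n. f k) = B ^ 4 + q ^ Suc n * E"
    by (metis dvd_mult2 dvd_def diff_eq_eq add.commute)
  have "q ^ Suc n = fps_X ^ (6 * Suc n)" by (simp only: q_def power_mult)
  with \<open>n \<ge> m\<close> have "fps_nth (q ^ Suc n * E) (6 * m) = 0" by (simp add: fps_X_power_mult_nth)
  then have "fps_nth (prodinf f) (6 * m) = fps_nth (B ^ 4) (6 * m)"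
    unfolding n[symmetric] E by simp
  then show ?thesis
    using fps_nth_pentagonal_power4[OF \<open>n \<ge> m\<close>] by (simp add: c_coeff_def f_def B_def q_def)
qed

section \<open>Counting by residues modulo 3\<close>

definition odd4_last3 :: "int \<Rightarrow> (int \<times> int \<times> int \<times> int) set" where
  "odd4_last3 N = {(x, y, z, w) \<in> odd4 N. 3 dvd w}"

text \<open>Multiplying by 8 and adding \<open>1 + 1 + 1 + 9 = 12\<close> turns the triangular terms
  into squares of \<open>2 * x - 1\<close>; the coefficient 9 is absorbed into
  \<open>3 * (2 * w - 1)\<close>.\<close>

lemma tri_reps_eq_card: "tri_reps 1 1 1 9 n = card (odd4_last3 (8 * int n + 12))"
proof -
  define f :: "int \<times> int \<times> int \<times> int \<Rightarrow> int \<times> int \<times> int \<times> int" where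
    "f = (\<lambda>(x, y, z, w). (2 * x - 1, 2 * y - 1, 2 * z - 1, 3 * (2 * w - 1)))"
  define g :: "int \<times> int \<times> int \<times> int \<Rightarrow> int \<times> int \<times> int \<times> int" where
    "g = (\<lambda>(x, y, z, w). ((x + 1) div 2, (y + 1) div 2, (z + 1) div 2, (w div 3 + 1) div 2))"
  define S where "S = {(x :: int, y :: int, z :: int, w :: int).
     int n = x * (x - 1) div 2 + y * (y - 1) div 2 + z * (z - 1) div 2 + 9 * (w * (w - 1) div 2)}"
  have sq: "(2 * x - 1) ^ 2 = 8 * (x * (x - 1) div 2) + 1" for x :: int
  proof -
    have "2 * (x * (x - 1) div 2) = x * (x - 1)" by simp
    then have "8 * (x * (x - 1) div 2) = 4 * (x * (x - 1))" by linarith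
    then show ?thesis by (simp add: power2_eq_square algebra_simps)
  qed
  have f: "f (x, y, z, w) \<in> odd4 (8 * int n + 12) \<longleftrightarrow> (x, y, z, w) \<in> S" for x y z w
  proof -
    define t :: "int \<Rightarrow> int" where "t x = x * (x - 1) div 2" for x
    have t: "(2 * x - 1) ^ 2 = 8 * t x + 1" for x using sq by (simp add: t_def)
    have "(3 * (2 * w - 1)) ^ 2 = 9 * (8 * t w + 1)" unfolding power_mult_distrib t by simp
    then have "(2 * x - 1) ^ 2 + (2 * y - 1) ^ 2 + (2 * z - 1) ^ 2 + (3 * (2 * w - 1)) ^ 2 = 8 * int n + 12
      \<longleftrightarrow> int n = t x + t y + t z + 9 * t w"
      unfolding t by auto
    then show ?thesis unfolding f_def S_def odd4_def t_def by auto
  qed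
  have "bij_betw f S (odd4_last3 (8 * int n + 12))"
  proof (rule bij_betw_byWitness[where f' = g])
    show "\<forall>v\<in>S. g (f v) = v" by (auto simp: f_def g_def)
    have fg: "f (g v) = v" if v: "v \<in> odd4_last3 (8 * int n + 12)" for v
    proof -
      obtain x y z w where "v = (x, y, z, w)" "odd x" "odd y" "odd z" "odd w" "3 dvd w"
        using v by (auto simp: odd4_last3_def odd4_def)
      then show ?thesis by (simp add: f_def g_def) presburger
    qed
    then show "\<forall>v\<in>odd4_last3 (8 * int n + 12). f (g v) = v" by blast
    show "f ` S \<subseteq> odd4_last3 (8 * int n + 12)"
    proof
      fix u assume "u \<in> f ` S"
      then obtain x y z w where u: "u = f (x, y, z, w)" and "(x, y, z, w) \<in> S" by auto
      then have "u \<in> odd4 (8 * int n + 12)" by (simp add: f)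
      with u show "u \<in> odd4_last3 (8 * int n + 12)" by (simp add: f_def odd4_last3_def)
    qed
    show "g ` odd4_last3 (8 * int n + 12) \<subseteq> S"
    proof
      fix u assume "u \<in> g ` odd4_last3 (8 * int n + 12)"
      then obtain v where v: "v \<in> odd4_last3 (8 * int n + 12)" "u = g v" by blast
      then have "f u \<in> odd4 (8 * int n + 12)" using fg[of v] by (auto simp: odd4_last3_def)
      then show "u \<in> S" by (cases u) (simp add: f)
    qed
  qed
  then have "card S = card (odd4_last3 (8 * int n + 12))" by (rule bij_betw_same_card)
  then show ?thesis by (simp add: tri_reps_def S_def)
qed

section \<open>Multiples of 3 among the four coordinates\<close>

lemma sum_odd4_swap:
  "(\<Sum>(x, y, z, w)\<in>odd4 N. f x y z w) = (\<Sum>(x, y, z, w)\<in>odd4 N. f w y z x)"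
  "(\<Sum>(x, y, z, w)\<in>odd4 N. f x y z w) = (\<Sum>(x, y, z, w)\<in>odd4 N. f y x z w)"
  "(\<Sum>(x, y, z, w)\<in>odd4 N. f x y z w) = (\<Sum>(x, y, z, w)\<in>odd4 N. f z y x w)"
proof -
  show "(\<Sum>(x, y, z, w)\<in>odd4 N. f x y z w) = (\<Sum>(x, y, z, w)\<in>odd4 N. f w y z x)"
    by (rule sum.reindex_bij_witness[of _ "\<lambda>(x, y, z, w). (w, y, z, x)" "\<lambda>(x, y, z, w). (w, y, z, x)"])
       (auto simp: odd4_def)
  show "(\<Sum>(x, y, z, w)\<in>odd4 N. f x y z w) = (\<Sum>(x, y, z, w)\<in>odd4 N. f y x z w)"
    by (rule sum.reindex_bij_witness[of _ "\<lambda>(x, y, z, w). (y, x, z, w)" "\<lambda>(x, y, z, w). (y, x, z, w)"])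
       (auto simp: odd4_def)
  show "(\<Sum>(x, y, z, w)\<in>odd4 N. f x y z w) = (\<Sum>(x, y, z, w)\<in>odd4 N. f z y x w)"
    by (rule sum.reindex_bij_witness[of _ "\<lambda>(x, y, z, w). (z, y, x, w)" "\<lambda>(x, y, z, w). (z, y, x, w)"])
       (auto simp: odd4_def)
qed

definition num_mult3 :: "int \<times> int \<times> int \<times> int \<Rightarrow> int" where
  "num_mult3 = (\<lambda>(x, y, z, w). of_bool (3 dvd x) + of_bool (3 dvd y) + of_bool (3 dvd z) + of_bool (3 dvd w))"

text \<open>Permuting coordinates shows that each of the four positions is divisible by 3 equally
  often.\<close>

lemma sum_num_mult3: "(\<Sum>v\<in>odd4 N. num_mult3 v) = 4 * int (card (odd4_last3 N))"
proof -
  define F :: "int \<Rightarrow> int \<Rightarrow> int \<Rightarrow> int \<Rightarrow> int" where "F x y z w = of_bool (3 dvd x)" for x y z w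
  have "int (card (odd4_last3 N)) = (\<Sum>v\<in>odd4_last3 N. 1)" by simp
  also have "\<dots> = (\<Sum>(x, y, z, w)\<in>odd4 N. F w y z x)"
    by (rule sum.mono_neutral_cong_left) (auto simp: odd4_last3_def F_def)
  finally have "int (card (odd4_last3 N)) = (\<Sum>(x, y, z, w)\<in>odd4 N. F w y z x)" .
  moreover have "(\<Sum>v\<in>odd4 N. num_mult3 v) = (\<Sum>(x, y, z, w)\<in>odd4 N. F x y z w) +
     (\<Sum>(x, y, z, w)\<in>odd4 N. F y x z w) + (\<Sum>(x, y, z, w)\<in>odd4 N. F z y x w) +
     (\<Sum>(x, y, z, w)\<in>odd4 N. F w y z x)"
    by (simp add: F_def num_mult3_def case_prod_unfold sum.distrib)
  ultimately show ?thesis using sum_odd4_swap[of F N] by simp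
qed

lemma square_mod_3: "x ^ 2 mod 3 = of_bool (\<not> 3 dvd x)" for x :: int
proof -
  have "x mod 3 = 0 \<or> x mod 3 = 1 \<or> x mod 3 = 2" by presburger
  then show ?thesis
    by (subst power_mod[symmetric]) (auto simp: dvd_eq_mod_eq_0)
qed

text \<open>Squares are 0 or 1 modulo 3, so \<open>N\<close> is congruent to the number of
  coordinates prime to 3.\<close>

lemma num_mult3_mod_3:
  assumes "(x, y, z, w) \<in> odd4 N"
  shows "(4 - num_mult3 (x, y, z, w)) mod 3 = N mod 3"
proof -
  have "(p + q + r + s) mod 3 = (p mod 3 + q mod 3 + r mod 3 + s mod 3) mod 3" for p q r s :: int
    by (intro mod_add_cong) simp_all
  then have "N mod 3 = (x^2 mod 3 + y^2 mod 3 + z^2 mod 3 + w^2 mod 3) mod 3"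
    using assms by (auto simp: odd4_def)
  then show ?thesis by (simp add: square_mod_3 num_mult3_def)
qed

text \<open>The only number from 0 to 4 congruent to 2 modulo 3 is 2, so exactly two coordinates are
  multiples of 3.\<close>

lemma card_odd4_last3_2:
  assumes "N mod 3 = 2"
  shows "2 * card (odd4_last3 N) = card (odd4 N)"
proof -
  have "(\<Sum>v\<in>odd4 N. num_mult3 v) = (\<Sum>v\<in>odd4 N. 2)"
  proof (rule sum.cong)
    fix v assume "v \<in> odd4 N"
    then have "(4 - num_mult3 v) mod 3 = 2" using num_mult3_mod_3 assms by (cases v) auto
    then show "num_mult3 v = 2" by (cases v) (auto simp: num_mult3_def of_bool_def split: if_splits)
  qed simp
  then show ?thesis unfolding sum_num_mult3 by simp
qed

lemma card_odd4_9: "card {(x, y, z, w) \<in> odd4 (9 * N). 3 dvd x \<and> 3 dvd y \<and> 3 dvd z \<and> 3 dvd w} = card (odd4 N)"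
proof -
  have sq: "x ^ 2 = 9 * (x div 3) ^ 2" if "3 dvd x" for x :: int
    using that by (auto simp: power_mult_distrib elim!: dvdE)
  have "bij_betw (\<lambda>(x, y, z, w). (3 * x, 3 * y, 3 * z, 3 * w)) (odd4 N)
     {(x, y, z, w) \<in> odd4 (9 * N). 3 dvd x \<and> 3 dvd y \<and> 3 dvd z \<and> 3 dvd w}"
    by (rule bij_betw_byWitness[where f' = "\<lambda>(x, y, z, w). (x div 3, y div 3, z div 3, w div 3)"])
       (auto simp: odd4_def power_mult_distrib sq)
  from bij_betw_same_card[OF this] show ?thesis ..
qed

text \<open>Here 0 or 3 coordinates are prime to 3, so \<open>num_mult3\<close> is 4 on the last set
  and 1 elsewhere.\<close>

lemma card_odd4_last3_0:
  assumes "N mod 3 = 0"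
  shows "4 * card (odd4_last3 N) = card (odd4 N) +
    3 * card {(x, y, z, w) \<in> odd4 N. 3 dvd x \<and> 3 dvd y \<and> 3 dvd z \<and> 3 dvd w}" (is "_ = _ + 3 * card ?A")
proof -
  have "(\<Sum>v\<in>odd4 N. num_mult3 v) = (\<Sum>v\<in>odd4 N. 1 + 3 * of_bool (v \<in> ?A))"
  proof (rule sum.cong)
    fix v assume v: "v \<in> odd4 N"
    then have "(4 - num_mult3 v) mod 3 = 0" using num_mult3_mod_3 assms by (cases v) auto
    then show "num_mult3 v = 1 + 3 * of_bool (v \<in> ?A)" using v
      by (cases v) (auto simp: num_mult3_def of_bool_def split: if_splits)
  qed simp
  also have "\<dots> = int (card (odd4 N)) + 3 * (\<Sum>v\<in>odd4 N. of_bool (v \<in> ?A))"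
    by (simp add: sum.distrib sum_distrib_left)
  also have "(\<Sum>v\<in>odd4 N. of_bool (v \<in> ?A)) = (\<Sum>v\<in>?A. 1 :: int)"
    by (rule sum.mono_neutral_cong_right) (auto split: if_splits)
  finally show ?thesis unfolding sum_num_mult3 by simp
qed

definition odd4_first_not3 :: "int \<Rightarrow> (int \<times> int \<times> int \<times> int) set" where
  "odd4_first_not3 N = {(x, y, z, w) \<in> odd4 N. \<not> 3 dvd x \<and> 3 dvd y \<and> 3 dvd z \<and> 3 dvd w}"

definition odd4_none3 :: "int \<Rightarrow> (int \<times> int \<times> int \<times> int) set" where
  "odd4_none3 N = {(x, y, z, w) \<in> odd4 N. \<not> 3 dvd x \<and> \<not> 3 dvd y \<and> \<not> 3 dvd z \<and> \<not> 3 dvd w}"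

text \<open>Here 1 or 4 coordinates are prime to 3. By symmetry a lone one occurs equally often in
  each position, and three of the four positions leave the last coordinate divisible by 3.\<close>

lemma card_odd4_last3_1:
  assumes "N mod 3 = 1"
  shows "card (odd4_last3 N) = 3 * card (odd4_first_not3 N)" "card (odd4 N) = card (odd4_none3 N) + 4 * card (odd4_first_not3 N)"
proof -
  define F :: "int \<Rightarrow> int \<Rightarrow> int \<Rightarrow> int \<Rightarrow> int" where
    "F x y z w = of_bool (\<not> 3 dvd x \<and> 3 dvd y \<and> 3 dvd z \<and> 3 dvd w)" for x y z w
  have Y: "(\<Sum>(x, y, z, w)\<in>odd4 N. F x y z w) = int (card (odd4_first_not3 N))"
  proof -
    have "(\<Sum>(x, y, z, w)\<in>odd4 N. F x y z w) = (\<Sum>v\<in>odd4_first_not3 N. 1 :: int)"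
      by (rule sum.mono_neutral_cong_right) (auto simp: odd4_first_not3_def F_def)
    then show ?thesis by simp
  qed
  have B: "(\<Sum>v\<in>odd4 N. of_bool (v \<in> odd4_none3 N)) = int (card (odd4_none3 N))"
  proof -
    have "(\<Sum>v\<in>odd4 N. of_bool (v \<in> odd4_none3 N)) = (\<Sum>v\<in>odd4_none3 N. 1 :: int)"
      by (rule sum.mono_neutral_cong_right) (auto simp: odd4_none3_def split: if_splits)
    then show ?thesis by simp
  qed
  \<comment> \<open>The indicator of exactly one coordinate being prime to 3; each summand moves one
    position to the front.\<close>
  define G where "G = (\<lambda>(x, y, z, w). F x y z w + F y x z w + F z y x w + F w y z x)"
  have "sum G (odd4 N) =
       (\<Sum>(x, y, z, w)\<in>odd4 N. F x y z w) + (\<Sum>(x, y, z, w)\<in>odd4 N. F y x z w)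
       + (\<Sum>(x, y, z, w)\<in>odd4 N. F z y x w) + (\<Sum>(x, y, z, w)\<in>odd4 N. F w y z x)"
    unfolding G_def by (simp only: case_prod_unfold sum.distrib)
  then have S: "sum G (odd4 N) = 4 * int (card (odd4_first_not3 N))"
    using sum_odd4_swap[of F N] Y by simp
  have G: "num_mult3 v = 3 * G v" "of_bool (v \<in> odd4_none3 N) + G v = 1" if "v \<in> odd4 N" for v
  proof -
    obtain x y z w where v: "v = (x, y, z, w)" by (cases v)
    show "num_mult3 v = 3 * G v" "of_bool (v \<in> odd4_none3 N) + G v = 1"
      using num_mult3_mod_3[OF that[unfolded v]] that unfolding v assms
      by (cases "3 dvd x"; cases "3 dvd y"; cases "3 dvd z"; cases "3 dvd w";
          simp add: num_mult3_def G_def F_def odd4_none3_def)+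
  qed
  have "(\<Sum>v\<in>odd4 N. num_mult3 v) = 3 * sum G (odd4 N)"
    unfolding sum_distrib_left by (rule sum.cong) (simp_all add: G)
  then show "card (odd4_last3 N) = 3 * card (odd4_first_not3 N)" unfolding sum_num_mult3 S by simp
  have "int (card (odd4 N)) = (\<Sum>v\<in>odd4 N. of_bool (v \<in> odd4_none3 N) + G v)"
    by (simp add: G)
  also have "\<dots> = int (card (odd4_none3 N)) + 4 * int (card (odd4_first_not3 N))"
    unfolding sum.distrib S B ..
  finally show "card (odd4 N) = card (odd4_none3 N) + 4 * card (odd4_first_not3 N)" by simp
qed

section \<open>Representations through the numbers \<open>6 * j + 1\<close>\<close>

lemma square_6: "(6 * j + 1) ^ 2 = 24 * pent j + 1"
  using two_pent[of j] by (simp add: power2_eq_square algebra_simps)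

lemma pent4_iff:
  "(a, b, c, d) \<in> pent4 m \<longleftrightarrow>
    (6 * a + 1) ^ 2 + (6 * b + 1) ^ 2 + (6 * c + 1) ^ 2 + (6 * d + 1) ^ 2 = 24 * int m + 4"
  unfolding square_6 pent4_def by auto

definition signs :: "int set" where
  "signs = {- 1, 1}"

text \<open>An odd number prime to 3 is \<open>\<plusminus> (6 * j + 1)\<close> for a unique sign
  and a unique \<open>j\<close>; the four signs are independent.\<close>

lemma card_odd4_none3: "card (odd4_none3 (24 * int m + 4)) = 16 * card (pent4 m)"
proof -
  define e :: "int \<Rightarrow> int" where "e x = (if x mod 3 = 1 then 1 else - 1)" for x
  define f :: "(int \<times> int \<times> int \<times> int) \<times> int \<times> int \<times> int \<times> int \<Rightarrow> int \<times> int \<times> int \<times> int" where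
    "f = (\<lambda>((e1, e2, e3, e4), a, b, c, d). (e1 * (6 * a + 1), e2 * (6 * b + 1), e3 * (6 * c + 1), e4 * (6 * d + 1)))"
  define g :: "int \<times> int \<times> int \<times> int \<Rightarrow> (int \<times> int \<times> int \<times> int) \<times> int \<times> int \<times> int \<times> int" where
    "g = (\<lambda>(x, y, z, w). ((e x, e y, e z, e w), e x * x div 6, e y * y div 6, e z * z div 6, e w * w div 6))"
  have e_signs: "e x \<in> signs" for x by (simp add: e_def signs_def)
  have e1: "e (u * (6 * j + 1)) = u" "u * (u * (6 * j + 1)) div 6 = j" if "u \<in> signs" for u j
  proof -
    show "e (u * (6 * j + 1)) = u" using that by (auto simp: e_def signs_def; presburger)
    show "u * (u * (6 * j + 1)) div 6 = j" using that by (auto simp: signs_def)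
  qed
  have e2: "e x * (6 * (e x * x div 6) + 1) = x" "6 * (e x * x div 6) + 1 = e x * x"
    if "odd x" "\<not> 3 dvd x" for x
  proof -
    show *: "6 * (e x * x div 6) + 1 = e x * x" using that by (auto simp: e_def; presburger)
    show "e x * (6 * (e x * x div 6) + 1) = x" unfolding * by (simp add: e_def)
  qed
  have sq: "(u * x) ^ 2 = x ^ 2" if "u \<in> signs" for u x :: int
    using that by (auto simp: power_mult_distrib signs_def)
  have nd: "\<not> 3 dvd u * (6 * j + 1)" "odd (u * (6 * j + 1))" if "u \<in> signs" for u j :: int
  proof -
    show "\<not> 3 dvd u * (6 * j + 1)" using that by (auto simp: signs_def; presburger)
    show "odd (u * (6 * j + 1))" using that by (auto simp: signs_def)
  qed
  have "bij_betw f ((signs \<times> signs \<times> signs \<times> signs) \<times> pent4 m) (odd4_none3 (24 * int m + 4))"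
  proof (rule bij_betw_byWitness[where f' = g])
    show "\<forall>v\<in>(signs \<times> signs \<times> signs \<times> signs) \<times> pent4 m. g (f v) = v"
      unfolding f_def g_def by (clarsimp simp: e1)
    show "\<forall>v\<in>odd4_none3 (24 * int m + 4). f (g v) = v"
      unfolding f_def g_def by (clarsimp simp: odd4_none3_def odd4_def e2(1))
    show "f ` ((signs \<times> signs \<times> signs \<times> signs) \<times> pent4 m) \<subseteq> odd4_none3 (24 * int m + 4)"
      unfolding f_def odd4_none3_def odd4_def
      by (clarsimp simp: nd sq pent4_iff simp del: even_mult_iff)
    show "g ` odd4_none3 (24 * int m + 4) \<subseteq> (signs \<times> signs \<times> signs \<times> signs) \<times> pent4 m"
      unfolding g_def odd4_none3_def odd4_def
      by (clarsimp simp: e_signs pent4_iff e2(2) sq)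
  qed
  then have "card (odd4_none3 (24 * int m + 4)) = card ((signs \<times> signs \<times> signs \<times> signs) \<times> pent4 m)"
    by (simp add: bij_betw_same_card)
  then show ?thesis by (simp add: card_cartesian_product signs_def)
qed


text \<open>
  Up to signs, the bijection is the orthogonal map with rows \<open>(1, \<plusminus> 1, \<plusminus> 1, \<plusminus> 1) / 2\<close> applied to the vector
  with coordinates \<open>6 j + 1\<close>. Its image consists of odd numbers exactly when the sum of the four indices
  is odd, and all its coordinates but the first are divisible by 3.
\<close>
lemma card_odd4_first_not3: "card (odd4_first_not3 (24 * int m + 4)) = 4 * card {(a, b, c, d) \<in> pent4 m. odd (a + b + c + d)}"
proof -
  define J where "J = {(a, b, c, d) \<in> pent4 m. odd (a + b + c + d)}"
  \<comment> \<open>The sign that makes \<open>e x * x\<close> congruent to 2 modulo 3, like the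
    first coordinate \<open>3 * (a + b + c + d) + 2\<close>.\<close>
  define e where "e x = (if x mod 3 = 2 then 1 else - 1 :: int)" for x :: int
  \<comment> \<open>The sign of \<open>y\<close> that makes the total 2 modulo 4. Exactly one works,
    since negating the odd \<open>y\<close> shifts the even total by 2 modulo 4. The two signs
    \<open>e\<close> and \<open>e'\<close> account for the factor 4.\<close>
  define e' where "e' x y z w = (if (e x * x + y + z + w) mod 4 = 2 then 1 else - 1 :: int)" for x y z w :: int
  define f :: "(int \<times> int) \<times> int \<times> int \<times> int \<times> int \<Rightarrow> int \<times> int \<times> int \<times> int" where
    "f = (\<lambda>((u, v), a, b, c, d). (u * (3 * (a + b + c + d) + 2), v * (3 * (a + b - c - d)),
            3 * (a - b + c - d), 3 * (a - b - c + d)))"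
  \<comment> \<open>The orthogonal matrix is its own inverse, so each combination is
    \<open>2 * (6 * a + 1) = 12 * a + 2\<close> for the index in question, and division by 12
    discards the 2.\<close>
  define g :: "int \<times> int \<times> int \<times> int \<Rightarrow> (int \<times> int) \<times> int \<times> int \<times> int \<times> int" where
    "g = (\<lambda>(x, y, z, w). let u = e x; v = e' x y z w in ((u, v),
       (u * x + v * y + z + w) div 12, (u * x + v * y - z - w) div 12,
       (u * x - v * y + z - w) div 12, (u * x - v * y - z + w) div 12))"
  have gf: "g (f ((u, v), a, b, c, d)) = ((u, v), a, b, c, d)"
    if "u \<in> signs" "v \<in> signs" "odd (a + b + c + d)" for u v a b c d
  proof -
    have u: "e (u * (3 * (a + b + c + d) + 2)) = u"
      using that(1) by (auto simp: signs_def e_def; presburger)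
    from that(3) have "odd (a + b - c - d)" by presburger
    then obtain k where k: "a + b - c - d = 2 * k + 1" by (elim oddE)
    have uu: "u * (u * k) = k" "v * (v * k) = k" for k using that(1,2) by (auto simp: signs_def)
    have "e' (u * (3 * (a + b + c + d) + 2)) (v * (3 * (a + b - c - d))) (3 * (a - b + c - d)) (3 * (a - b - c + d)) = v"
      proof -
      \<comment> \<open>The total is \<open>12 * a + 2\<close> for \<open>v = 1\<close>; for
        \<open>v = - 1\<close> it loses \<open>6 * (2 * k + 1)\<close> and becomes a multiple of
        4.\<close>
      have "(3 * (a + b + c + d) + 2 + v * (3 * (a + b - c - d)) + 3 * (a - b + c - d) + 3 * (a - b - c + d)) =
        (if v = 1 then 4 * (3 * a) + 2 else 4 * (3 * a - 3 * k - 1))"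
        using that(2) k by (auto simp: signs_def)
      moreover have "(4 * (3 * a) + 2) mod 4 = 2" "(4 * (3 * a - 3 * k - 1)) mod 4 \<noteq> 2"
        by presburger+
      ultimately show ?thesis unfolding e'_def u uu using that(2) by (auto simp: signs_def)
    qed
    note v = this
    show ?thesis unfolding g_def f_def prod.case Let_def v u uu by simp
  qed
  have fJ: "f ((u, v), a, b, c, d) \<in> odd4_first_not3 (24 * int m + 4)"
    if "u \<in> signs" "v \<in> signs" "(a, b, c, d) \<in> pent4 m" "odd (a + b + c + d)" for u v a b c d
  proof -
    have sq: "(u * k) ^ 2 = k ^ 2" "(v * k) ^ 2 = k ^ 2" for k
      using that(1,2) by (auto simp: power_mult_distrib signs_def)
    have "(3 * (a + b + c + d) + 2) ^ 2 + (3 * (a + b - c - d)) ^ 2 + (3 * (a - b + c - d)) ^ 2 + (3 * (a - b - c + d)) ^ 2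
      = (6 * a + 1) ^ 2 + (6 * b + 1) ^ 2 + (6 * c + 1) ^ 2 + (6 * d + 1) ^ 2"
      by (simp add: power2_eq_square algebra_simps)
    moreover have "odd (u * k) \<longleftrightarrow> odd k" "odd (v * k) \<longleftrightarrow> odd k" "3 dvd u * k \<longleftrightarrow> 3 dvd k" for k
      using that(1,2) by (auto simp: signs_def)
    moreover have "\<not> 3 dvd 3 * (a + b + c + d) + 2" by presburger
    moreover have "odd (3 * (a + b + c + d) + 2)" "odd (3 * (a + b - c - d))" "odd (3 * (a - b + c - d))"
      "odd (3 * (a - b - c + d))" using that(4) by presburger+
    ultimately show ?thesis using that(3) unfolding f_def odd4_first_not3_def odd4_def pent4_iff prod.case mem_Collect_eq sq
      by (simp del: even_mult_iff dvd_add_right_iff dvd_add_left_iff)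
  qed
  have fg: "f (g (x, y, z, w)) = (x, y, z, w) \<and> g (x, y, z, w) \<in> (signs \<times> signs) \<times> J"
    if Y: "(x, y, z, w) \<in> odd4_first_not3 (24 * int m + 4)" for x y z w
  proof -
    define u where "u = e x"
    define v where "v = e' x y z w"
    have signs: "u \<in> signs" "v \<in> signs" by (auto simp: u_def v_def e_def e'_def signs_def)
    have o: "odd x" "odd y" "odd z" "odd w" "\<not> 3 dvd x" "3 dvd y" "3 dvd z" "3 dvd w" and
      N: "x ^ 2 + y ^ 2 + z ^ 2 + w ^ 2 = 24 * int m + 4" using Y by (auto simp: odd4_first_not3_def odd4_def)
    have uu: "u * (u * k) = k" "v * (v * k) = k" for k using signs by (auto simp: signs_def)
    have sq: "(u * k) ^ 2 = k ^ 2" "(v * k) ^ 2 = k ^ 2" for k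
      using signs by (auto simp: power_mult_distrib signs_def)
    have "(u * x) mod 3 = 2" using o(5) unfolding u_def e_def by (simp; presburger)
    moreover have "3 dvd v * y" "odd (v * y)" "odd (u * x)" using signs o by (auto simp: signs_def)
    moreover have "(u * x + v * y + z + w) mod 4 = 2"
    proof -
      define s where "s = u * x + y + z + w"
      have v: "v = (if s mod 4 = 2 then 1 else - 1)" by (simp only: v_def e'_def s_def u_def)
      have "even s" unfolding s_def using o \<open>odd (u * x)\<close> by simp
      then have "(s - 2 * y) mod 4 = 2" if "s mod 4 \<noteq> 2" using that \<open>odd y\<close> by presburger
      moreover have "u * x + v * y + z + w = (if s mod 4 = 2 then s else s - 2 * y)"
        by (simp add: v s_def)
      ultimately show ?thesis by simp
    qed
    \<comment> \<open>After removing the factor 3, the reduced coordinates sum to some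
      \<open>4 * a\<close>. Negating two of the odd numbers \<open>Y'\<close>, \<open>z'\<close>,
      \<open>w'\<close> changes this by twice an even number, so the other three combinations are
      multiples of 4 too.\<close>
    moreover have "\<exists>a b c d. X + Y + z + w = 12 * a + 2 \<and> X + Y - z - w = 12 * b + 2 \<and>
        X - Y + z - w = 12 * c + 2 \<and> X - Y - z + w = 12 * d + 2"
      if XY: "X mod 3 = 2" "3 dvd Y" "odd Y" "odd X" "(X + Y + z + w) mod 4 = 2" for X Y
    proof -
      obtain Y' z' w' where Y': "Y = 3 * Y'" "z = 3 * z'" "w = 3 * w'"
        using XY(2) o(7,8) by (elim dvdE)
      with XY(3) o(3,4) have "odd Y'" "odd z'" "odd w'" by simp_all
      then obtain k l r where klr: "z' + w' = 2 * k" "Y' + w' = 2 * l" "Y' + z' = 2 * r"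
        by (metis odd_even_add evenE)
      obtain X' where X': "X = 3 * X' + 2" using XY(1) by (metis mult_div_mod_eq)
      have "s mod 4 = 0" if "(3 * s + 2) mod 4 = 2" for s :: int using that by presburger
      from this[of "X' + Y' + z' + w'"] XY(5) have "4 dvd X' + Y' + z' + w'"
        unfolding X' Y' by (simp add: algebra_simps dvd_eq_mod_eq_0)
      then obtain a where a: "X' + Y' + z' + w' = 4 * a" by (elim dvdE)
      show ?thesis
        by (rule exI[of _ a], rule exI[of _ "a - k"], rule exI[of _ "a - l"], rule exI[of _ "a - r"])
           (use a klr X' Y' in auto)
    qed
    ultimately obtain a b c d where abcd: "u * x + v * y + z + w = 12 * a + 2"
      "u * x + v * y - z - w = 12 * b + 2" "u * x - v * y + z - w = 12 * c + 2"
      "u * x - v * y - z + w = 12 * d + 2" by blast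
    then have g: "g (x, y, z, w) = ((u, v), a, b, c, d)"
      unfolding g_def by (simp add: u_def[symmetric] v_def[symmetric] Let_def)
    have "X = 3 * (a + b + c + d) + 2 \<and> Y = 3 * (a + b - c - d) \<and>
        z = 3 * (a - b + c - d) \<and> w = 3 * (a - b - c + d)"
      if "X + Y + z + w = 12 * a + 2" "X + Y - z - w = 12 * b + 2" "X - Y + z - w = 12 * c + 2"
        "X - Y - z + w = 12 * d + 2" for X Y :: int
      using that by auto
    from this[OF abcd] have ux: "u * x = 3 * (a + b + c + d) + 2"
      and vy: "v * y = 3 * (a + b - c - d)"
      and z: "z = 3 * (a - b + c - d)" and w: "w = 3 * (a - b - c + d)" by blast+
    have "u * (3 * (a + b + c + d) + 2) = x" "v * (3 * (a + b - c - d)) = y"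
      unfolding ux[symmetric] vy[symmetric] by (rule uu)+
    then have fg: "f (g (x, y, z, w)) = (x, y, z, w)" unfolding g f_def by (simp add: z w)
    have "(6 * a + 1) ^ 2 + (6 * b + 1) ^ 2 + (6 * c + 1) ^ 2 + (6 * d + 1) ^ 2 =
       (u * x) ^ 2 + (v * y) ^ 2 + z ^ 2 + w ^ 2"
      unfolding ux vy z w by (simp add: power2_eq_square algebra_simps)
    then have "(a, b, c, d) \<in> pent4 m" unfolding sq N pent4_iff .
    moreover have "odd (a + b + c + d)" using \<open>odd (u * x)\<close> unfolding ux by presburger
    ultimately show ?thesis using fg signs by (simp add: g J_def)
  qed
  have "bij_betw f ((signs \<times> signs) \<times> J) (odd4_first_not3 (24 * int m + 4))"
  proof (rule bij_betw_byWitness[where f' = g])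
    show "\<forall>v\<in>(signs \<times> signs) \<times> J. g (f v) = v" by (clarsimp simp: J_def gf)
    show "f ` ((signs \<times> signs) \<times> J) \<subseteq> odd4_first_not3 (24 * int m + 4)" by (clarsimp simp: J_def fJ)
    have "f (g v) = v \<and> g v \<in> (signs \<times> signs) \<times> J" if "v \<in> odd4_first_not3 (24 * int m + 4)" for v
      using that fg by (metis prod_cases4)
    then show "\<forall>v\<in>odd4_first_not3 (24 * int m + 4). f (g v) = v"
      and "g ` odd4_first_not3 (24 * int m + 4) \<subseteq> (signs \<times> signs) \<times> J" by blast+
  qed
  then have "card (odd4_first_not3 (24 * int m + 4)) = card ((signs \<times> signs) \<times> J)"
    by (simp add: bij_betw_same_card)
  then show ?thesis by (simp add: card_cartesian_product signs_def J_def)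
qed

text \<open>The signed sum is the total count minus twice the negative terms; this makes
  \<open>c_coeff\<close> comparable with the cardinalities above.\<close>

lemma c_coeff_card:
  "c_coeff (6 * m + 1) = int (card (pent4 m)) - 2 * int (card {(a, b, c, d) \<in> pent4 m. odd (a + b + c + d)})"
    (is "_ = _ - 2 * int (card ?J)")
proof -
  have "c_coeff (6 * m + 1) = (\<Sum>v\<in>pent4 m. 1 - 2 * (if v \<in> ?J then 1 else 0))"
    unfolding c_coeff_eq by (rule sum.cong) (auto simp: parity_sign_def split: if_splits)
  also have "\<dots> = int (card (pent4 m)) - 2 * (\<Sum>v\<in>pent4 m. if v \<in> ?J then 1 else 0)"
    by (simp only: sum_subtractf sum_distrib_left[symmetric] sum_constant mult_1_right)
  also have "(\<Sum>v\<in>pent4 m. if v \<in> ?J then 1 else 0) = (\<Sum>v\<in>?J. 1 :: int)"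
    by (rule sum.mono_neutral_cong_right) (auto simp: finite_pent4)
  finally show ?thesis by simp
qed

section \<open>The three residue classes of \<open>n\<close>\<close>

theorem theorem4p4:
  fixes n :: nat
  assumes "n \<ge> 1"
  shows "int (tri_reps 1 1 1 9 n) =
    (if n mod 3 = 0 then
       4 * int (divisor_sigma (2 * of_nat n + 3)) + 12 * int (divisor_sigma ((2 * of_nat n + 3) / 9))
     else if n mod 3 = 1 then
       8 * int (divisor_sigma (2 * of_nat n + 3))
     else
       4 * (int (divisor_sigma (2 * of_nat n + 3)) - c_coeff (2 * n + 3)))"
proof -
  define M where "M = 2 * n + 3"
  define \<sigma> where "\<sigma> m = (\<Sum>d | d dvd m. d)" for m :: nat
  have M: "odd M" "M > 0" by (simp_all add: M_def)
  have rat: "2 * of_nat n + 3 = (of_nat M :: rat)" by (simp add: M_def)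
  have \<sigma>: "divisor_sigma (of_nat m) = \<sigma> m" if "m > 0" for m
    using divisor_sigma_of_nat[OF that] by (simp add: \<sigma>_def)
  have t: "tri_reps 1 1 1 9 n = card (odd4_last3 (4 * int M))"
    unfolding tri_reps_eq_card by (simp add: M_def)
  have D: "card (odd4 (4 * int M)) = 16 * \<sigma> M" unfolding \<sigma>_def by (rule card_odd4[OF M(1)])
  consider "n mod 3 = 0" | "n mod 3 = 1" | "n mod 3 = 2" by linarith
  then show ?thesis
  proof cases
    case 1
    then have "(4 * int M) mod 3 = 0" unfolding M_def by presburger
    from card_odd4_last3_0[OF this]
    have "4 * card (odd4_last3 (4 * int M)) = 16 * \<sigma> M + 3 *
      card {(x, y, z, w) \<in> odd4 (4 * int M). 3 dvd x \<and> 3 dvd y \<and> 3 dvd z \<and> 3 dvd w}" (is "_ = _ + 3 * card ?A")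
      unfolding D .
    \<comment> \<open>Dividing all coordinates by 3 leads to the representations of
      \<open>4 * M / 9\<close>. If 9 does not divide \<open>M\<close> there are none, matching the
      value 0 of \<open>divisor_sigma\<close> at a non-integer.\<close>
    moreover have "card ?A = 16 * divisor_sigma (of_nat M / 9)"
    proof (cases "9 dvd M")
      case True
      then obtain k where k: "M = 9 * k" by (elim dvdE)
      then have "card ?A = card (odd4 (4 * int k))" using card_odd4_9[of "4 * int k"] by simp
      moreover have "odd k" "k > 0" using M k by auto
      moreover have "of_nat M / 9 = (of_nat k :: rat)" by (simp add: k)
      ultimately show ?thesis using \<sigma>[of k] by (simp add: card_odd4 \<sigma>_def)
    next
      case False
      have "9 dvd 4 * int M" if "(x, y, z, w) \<in> ?A" for x y z w
      proof -
        have "9 dvd x ^ 2" "9 dvd y ^ 2" "9 dvd z ^ 2" "9 dvd w ^ 2"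
          using that dvd_power_same[of 3 _ 2] by auto
        then have "9 dvd x ^ 2 + y ^ 2 + z ^ 2 + w ^ 2" by (intro dvd_add)
        then show ?thesis using that by (auto simp: odd4_def)
      qed
      moreover have "\<not> 9 dvd 4 * int M" using False by presburger
      ultimately have "card ?A = 0" by (subst card_eq_0_iff) blast
      moreover have "divisor_sigma (of_nat M / 9) = 0"
      proof -
        have "of_nat M / 9 \<noteq> (of_nat m :: rat)" for m
        proof
          assume "of_nat M / 9 = (of_nat m :: rat)"
          then have "(of_nat M :: rat) = of_nat (9 * m)" by (simp add: field_simps)
          then have "M = 9 * m" by (simp only: of_nat_eq_iff)
          with False show False by simp
        qed
        then show ?thesis by (simp add: divisor_sigma_def)
      qed
      ultimately show ?thesis by simp
    qed
    ultimately show ?thesis unfolding t rat \<sigma>[OF M(2)] using 1 by simp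
  next
    case 2
    then have "(4 * int M) mod 3 = 2" unfolding M_def by presburger
    from card_odd4_last3_2[OF this] show ?thesis unfolding t rat D \<sigma>[OF M(2)] using 2 by simp
  next
    case 3
    define m where "m = M div 6"
    have m: "M = 6 * m + 1" using 3 unfolding m_def M_def by presburger
    then have N: "4 * int M = 24 * int m + 4" by simp
    have "(24 * int m + 4) mod 3 = 1" by presburger
    note Z = card_odd4_last3_1[OF this]
    have "c_coeff M = int (card (pent4 m)) - 2 * int (card {(a, b, c, d) \<in> pent4 m. odd (a + b + c + d)})"
      unfolding m by (rule c_coeff_card)
    \<comment> \<open>With \<open>P\<close> the size of \<open>pent4 m\<close> and \<open>J\<close>
      that of its part of odd index sum, \<open>\<sigma> M = P + J\<close> and
      \<open>c_coeff M = P - 2 * J\<close>, while the required count is \<open>3 * (4 * J)\<close>,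
      which is four times their difference.\<close>
    with Z D show ?thesis unfolding t rat \<sigma>[OF M(2)] N card_odd4_none3 card_odd4_first_not3 M_def[symmetric] using 3 by simp
  qed
qed

end
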